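(* Let $\mathbb{F}_q$ be the finite field with $q$ elements and suppose $\operatorname{char}(\mathbb{F}_q)>3$. Let $N_q$ be the number of $\mathbb{F}_q$-isomorphism classes of Legendre curves $E_\lambda: y^2=x(x-1)(x-\lambda)$ defined over $\mathbb{F}_q$ (that is, $\lambda\in\mathbb{F}_q$) with $\lambda(\lambda-1)\neq 0$. Then $$N_q=\begin{cases} \dfrac{7q+17}{24}, & \text{if } q\equiv 1 \pmod{24},\\[1ex] \dfrac{7q+13}{24}, & \text{if } q\equiv 5 \pmod{24},\\[1ex] \dfrac{q+2}{3}, & \text{if } q\equiv 7,19 \pmod{24},\\[1ex] \dfrac{q-2}{3}, & \text{if } q\equiv 11,23 \pmod{24},\\[1ex] \dfrac{7q+29}{24}, & \text{if } q\equiv 13 \pmod{24},\\[1ex] \dfrac{7q+1}{24}, & \text{if } q\equiv 17 \pmod{24}. \end{cases}$$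
   Context: Two elliptic curves over a field $K$ given by Weierstrass equations are $K$-isomorphic if and only if there exist $u,r,s,t\in K$ with $u\neq 0$ such that the change of variables $(X,Y)\mapsto(u^2X+r,\,u^3Y+u^2sX+t)$ maps the equation of the first to the equation of the second. For two curves $y^2=x^3+a_2x^2+a_4x+a_6$ and $y^2=x^3+a_2'x^2+a_4'x+a_6'$ over $K$ with $\operatorname{char}K\neq 2$, this means that there exist $u,r\in K$, $u\neq0$, with $u^2a_2'=a_2+3r$, $u^4a_4'=a_4+2ra_2+3r^2$, $u^6a_6'=a_6+ra_4+r^2a_2+r^3$. $N_q$ counts the equivalence classes of the curves $E_\lambda$, $\lambda\in\mathbb{F}_q\setminus\{0,1\}$, under $\mathbb{F}_q$-isomorphism. *)

theory Defs
  imports "HOL-Computational_Algebra.Computational_Algebra" "HOL-Number_Theory.Cong" "HOL-Library.Cardinality"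
begin

datatype 'a weierstrass = Weierstrass (a1: 'a) (a2: 'a) (a3: 'a) (a4: 'a) (a6: 'a)

(* Elements of 'a poly poly are read as polynomials in Y over K[X]: the outer variable is Y,
   the inner one X.  The equation
     Y^2 + a1 X Y + a3 Y = X^3 + a2 X^2 + a4 X + a6
   is identified with the polynomial "left-hand side minus right-hand side". *)
definition weierstrass_poly :: "'a::field weierstrass \<Rightarrow> 'a poly poly" where
  "weierstrass_poly E = [: - [: a6 E, a4 E, a2 E, 1 :], [: a3 E, a1 E :], 1 :]"

(* F(X, Y) is sent to F(u^2 X + r, u^3 Y + u^2 s X + t). *)
definition change_vars :: "'a::field \<Rightarrow> 'a \<Rightarrow> 'a \<Rightarrow> 'a \<Rightarrow> 'a poly poly \<Rightarrow> 'a poly poly" where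
  "change_vars u r s t F =
     pcompose (map_poly (\<lambda>p. pcompose p [: r, u ^ 2 :]) F) [: [: t, u ^ 2 * s :], [: u ^ 3 :] :]"

(* Two polynomials give the same equation when they differ by a nonzero constant factor;
   comparing the coefficients of Y^2 shows that this factor is u^6. *)
definition weierstrass_iso :: "'a::field weierstrass \<Rightarrow> 'a weierstrass \<Rightarrow> bool" where
  "weierstrass_iso E E' \<longleftrightarrow>
     (\<exists>u r s t. u \<noteq> 0 \<and>
        change_vars u r s t (weierstrass_poly E) = smult [: u ^ 6 :] (weierstrass_poly E'))"

definition legendre :: "'a::field \<Rightarrow> 'a weierstrass" where
  "legendre l = Weierstrass 0 (- (1 + l)) 0 l 0"

lemma weierstrass_poly_legendre:
  "weierstrass_poly (legendre l) = [: - ([:0, 1:] * [:-1, 1:] * [:- l, 1:]), 0, 1 :]"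
  by (simp add: weierstrass_poly_def legendre_def algebra_simps)

lemma weierstrass_iso_iff:
  "weierstrass_iso E E' \<longleftrightarrow>
     (\<exists>u r s t. u \<noteq> 0 \<and>
        u * a1 E' = a1 E + 2 * s \<and>
        u ^ 2 * a2 E' = a2 E - s * a1 E + 3 * r - s ^ 2 \<and>
        u ^ 3 * a3 E' = a3 E + r * a1 E + 2 * t \<and>
        u ^ 4 * a4 E' = a4 E - s * a3 E + 2 * r * a2 E - (t + r * s) * a1 E + 3 * r ^ 2 - 2 * s * t \<and>
        u ^ 6 * a6 E' = a6 E + r * a4 E + r ^ 2 * a2 E + r ^ 3 - t * a3 E - t ^ 2 - r * t * a1 E)"
proof -
  have "change_vars u r s t (weierstrass_poly E) = smult [: u ^ 6 :] (weierstrass_poly E') \<longleftrightarrow>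
        u * a1 E' = a1 E + 2 * s \<and>
        u ^ 2 * a2 E' = a2 E - s * a1 E + 3 * r - s ^ 2 \<and>
        u ^ 3 * a3 E' = a3 E + r * a1 E + 2 * t \<and>
        u ^ 4 * a4 E' = a4 E - s * a3 E + 2 * r * a2 E - (t + r * s) * a1 E + 3 * r ^ 2 - 2 * s * t \<and>
        u ^ 6 * a6 E' = a6 E + r * a4 E + r ^ 2 * a2 E + r ^ 3 - t * a3 E - t ^ 2 - r * t * a1 E"
    (is "?P \<longleftrightarrow> ?A1 \<and> ?A2 \<and> ?A3 \<and> ?A4 \<and> ?A6") if u: "u \<noteq> 0" for u r s t
  proof -
    have "?P \<longleftrightarrow>
        u ^ 5 * (a1 E + 2 * s) = u ^ 6 * a1 E' \<and>
        u ^ 4 * (a2 E - s * a1 E + 3 * r - s ^ 2) = u ^ 6 * a2 E' \<and>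
        u ^ 3 * (a3 E + r * a1 E + 2 * t) = u ^ 6 * a3 E' \<and>
        u ^ 2 * (a4 E - s * a3 E + 2 * r * a2 E - (t + r * s) * a1 E + 3 * r ^ 2 - 2 * s * t) = u ^ 6 * a4 E' \<and>
        a6 E + r * a4 E + r ^ 2 * a2 E + r ^ 3 - t * a3 E - t ^ 2 - r * t * a1 E = u ^ 6 * a6 E'"
    proof -
      have "change_vars u r s t (weierstrass_poly E) =
        [: [: - (a6 E + r * a4 E + r ^ 2 * a2 E + r ^ 3 - t * a3 E - t ^ 2 - r * t * a1 E),
              - (u ^ 2 * (a4 E - s * a3 E + 2 * r * a2 E - (t + r * s) * a1 E + 3 * r ^ 2 - 2 * s * t)),
              - (u ^ 4 * (a2 E - s * a1 E + 3 * r - s ^ 2)),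
              - (u ^ 6) :],
           [: u ^ 3 * (a3 E + r * a1 E + 2 * t), u ^ 5 * (a1 E + 2 * s) :],
           [: u ^ 6 :] :]"
        by (simp add: change_vars_def weierstrass_poly_def map_poly_pCons pcompose_pCons pcompose_1)
           (simp add: algebra_simps power2_eq_square power3_eq_cube eval_nat_numeral)
      moreover have "smult [: u ^ 6 :] (weierstrass_poly E') =
        [: [: - (u ^ 6 * a6 E'), - (u ^ 6 * a4 E'), - (u ^ 6 * a2 E'), - (u ^ 6) :],
           [: u ^ 6 * a3 E', u ^ 6 * a1 E' :], [: u ^ 6 :] :]"
        by (simp add: weierstrass_poly_def)
      ultimately show ?thesis
        by (simp only: pCons_eq_iff neg_equal_iff_equal) blast
    qed
    also have "\<dots> \<longleftrightarrow> ?A1 \<and> ?A2 \<and> ?A3 \<and> ?A4 \<and> ?A6"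
    proof -
      have *: "u ^ k * x = u ^ (k + n) * y \<longleftrightarrow> u ^ n * y = x" for k n :: nat and x y :: 'a
        using u by (auto simp: power_add mult.assoc)
      show ?thesis
        using *[of 5 _ 1] *[of 4 _ 2] *[of 3 _ 3] *[of 2 _ 4] *[of 0 _ 6] by simp
    qed
    finally show ?thesis .
  qed
  then show ?thesis
    unfolding weierstrass_iso_def by blast
qed

definition legendre_curves :: "'a::field weierstrass set" where
  "legendre_curves = {legendre l | l. l * (l - 1) \<noteq> 0}"

definition legendre_classes :: "'a::field weierstrass set set" where
  "legendre_classes =
     legendre_curves // {(E, E'). E \<in> legendre_curves \<and> E' \<in> legendre_curves \<and> weierstrass_iso E E'}"

end

theory Submission
  imports Defs
begin

text \<open>
  An isomorphism of \<open>E\<^sub>\<mu>\<close> with \<open>E\<^sub>\<lambda>\<close> is an affine map with square slope that carries \<open>{0, 1, \<mu>}\<close>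
  onto \<open>{0, 1, \<lambda>}\<close>. Hence \<open>\<mu>\<close> is one of the six cross ratios of \<open>\<lambda>\<close>, each being allowed
  exactly when one of \<open>1, -1, \<lambda>, -\<lambda>, \<lambda> - 1, 1 - \<lambda>\<close> is a square. The number of classes is the sum over
  \<open>\<lambda>\<close> of the reciprocal class sizes. Generically these sizes depend only on whether \<open>-1\<close>, \<open>\<lambda>\<close> and
  \<open>1 - \<lambda>\<close> are squares; the exceptions are \<open>-1, 2, 1/2\<close> and the roots of \<open>\<lambda>\<^sup>2 - \<lambda> + 1\<close>.
  Which of \<open>-1\<close> and \<open>2\<close> are squares and whether \<open>\<lambda>\<^sup>2 - \<lambda> + 1\<close> has roots need not be computed from
  \<open>q\<close>: the counts obtained are integers, and for each residue of \<open>q\<close> only one combination is integral.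
\<close>

section \<open>Weighted counting of equivalence classes\<close>

lemma card_quotient_sum:
  assumes "finite A" and R: "equiv A R"
  shows "real (card (A // R)) = (\<Sum>x\<in>A. 1 / real (card (R `` {x})))"
proof -
  have fin: "finite C" if "C \<in> A // R" for C
    using that assms finite_equiv_class[OF assms(1) equiv_type[OF R]] by blast
  have "(\<Sum>x\<in>A. 1 / real (card (R `` {x}))) = (\<Sum>x\<in>\<Union>(A // R). 1 / real (card (R `` {x})))"
    by (simp add: Union_quotient[OF R])
  also have "\<dots> = (\<Sum>C\<in>A // R. \<Sum>x\<in>C. 1 / real (card (R `` {x})))"
    using fin quotient_disj[OF R] by (subst sum.Union_disjoint) auto
  also have "\<dots> = (\<Sum>C\<in>A // R. 1)"
  proof (rule sum.cong[OF refl])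
    fix C assume C: "C \<in> A // R"
    \<comment> \<open>On a single class the weight is constant, so its members together contribute
      exactly one.\<close>
    have "(\<Sum>x\<in>C. 1 / real (card (R `` {x}))) = (\<Sum>x\<in>C. 1 / real (card C))"
    proof (rule sum.cong[OF refl])
      fix x assume "x \<in> C"
      then have "R `` {x} = C"
        using C R by (metis Image_singleton_iff equiv_class_eq_iff quotientE)
      then show "1 / real (card (R `` {x})) = 1 / real (card C)" by simp
    qed
    then show "(\<Sum>x\<in>C. 1 / real (card (R `` {x}))) = 1"
      using fin[OF C] in_quotient_imp_non_empty[OF R C] by simp
  qed
  finally show ?thesis by simp
qed

section \<open>Isomorphisms of Legendre curves and cross ratios\<close>

definition legendre_params :: "'a::field set" where
  "legendre_params = {l. l \<noteq> 0 \<and> l \<noteq> 1}"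

definition is_sq :: "'a::field \<Rightarrow> bool" where
  "is_sq x \<longleftrightarrow> (\<exists>y. y ^ 2 = x)"

text \<open>The square condition attached to each cross ratio is on the slope of an affine map from
  \<open>{0, 1, m}\<close> onto \<open>{0, 1, l}\<close>, that is, on the image of 1 minus the image
  of 0. The slope 1 of the first alternative is always a square.\<close>

definition legendre_class :: "'a::field \<Rightarrow> 'a set" where
  "legendre_class l = {m. m = l \<or> is_sq (- 1 :: 'a) \<and> m = 1 - l
     \<or> is_sq l \<and> m = 1 / l \<or> is_sq (- l) \<and> m = (l - 1) / l
     \<or> is_sq (l - 1) \<and> m = 1 / (1 - l) \<or> is_sq (1 - l) \<and> m = l / (l - 1)}"

lemma is_sq_power2 [simp]: "is_sq (x ^ 2)"
  by (auto simp: is_sq_def)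

lemma is_sq_1 [simp]: "is_sq (1 :: 'a::field)"
  using is_sq_power2[of "1 :: 'a"] by simp

text \<open>An admissible change of variables matches the cubics \<open>x (x - 1) (x - l)\<close>
  and \<open>x (x - 1) (x - m)\<close> up to the factor \<open>u ^ 6\<close>, and these are
  determined by their roots.\<close>

lemma weierstrass_iso_legendre_iff:
  fixes l m :: "'a::field"
  assumes two: "(2 :: 'a) \<noteq> 0" and l: "l \<noteq> 0" "l \<noteq> 1" and m: "m \<noteq> 0" "m \<noteq> 1"
  shows "weierstrass_iso (legendre l) (legendre m) \<longleftrightarrow>
         (\<exists>u r. u \<noteq> 0 \<and> (\<lambda>x. u ^ 2 * x + r) ` {0, 1, m} = {0, 1, l})"
proof -
  \<comment> \<open>Both curves have \<open>a1 = a3 = 0\<close>, so the corresponding equations read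
    \<open>2 * s = 0\<close> and \<open>2 * t = 0\<close>; as 2 is invertible, \<open>s\<close> and
    \<open>t\<close> vanish.\<close>
  have "weierstrass_iso (legendre l) (legendre m) \<longleftrightarrow>
     (\<exists>u r. u \<noteq> 0 \<and> u ^ 2 * (- (1 + m)) = - (1 + l) + 3 * r \<and>
        u ^ 4 * m = l + 2 * r * (- (1 + l)) + 3 * r ^ 2 \<and>
        0 = r * l + r ^ 2 * (- (1 + l)) + r ^ 3)"
    unfolding weierstrass_iso_iff legendre_def using two by auto
  also have "\<dots> \<longleftrightarrow> (\<exists>u r. u \<noteq> 0 \<and> (\<lambda>x. u ^ 2 * x + r) ` {0, 1, m} = {0, 1, l})"
  proof (intro ex_cong1 conj_cong refl iffI)
    fix u r :: 'a
    assume u: "u \<noteq> 0"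
    assume eqs: "u ^ 2 * (- (1 + m)) = - (1 + l) + 3 * r \<and>
        u ^ 4 * m = l + 2 * r * (- (1 + l)) + 3 * r ^ 2 \<and>
        0 = r * l + r ^ 2 * (- (1 + l)) + r ^ 3"
    \<comment> \<open>The three equations compare coefficients: composing the cubic of
      \<open>l\<close> with the affine map gives \<open>u ^ 6\<close> times the cubic of
      \<open>m\<close>. Hence roots go to roots.\<close>
    have poly: "(u ^ 2 * x + r) * (u ^ 2 * x + r - 1) * (u ^ 2 * x + r - l) =
        u ^ 6 * (x * (x - 1) * (x - m))" for x
    proof -
      have "(u ^ 2 * x + r) * (u ^ 2 * x + r - 1) * (u ^ 2 * x + r - l) =
          u ^ 6 * x ^ 3 + u ^ 4 * x ^ 2 * (- (1 + l) + 3 * r)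
          + u ^ 2 * x * (l + 2 * r * (- (1 + l)) + 3 * r ^ 2) + (r * l + r ^ 2 * (- (1 + l)) + r ^ 3)"
        by (simp add: algebra_simps eval_nat_numeral)
      also have "\<dots> = u ^ 6 * x ^ 3 + u ^ 4 * x ^ 2 * (u ^ 2 * (- (1 + m))) + u ^ 2 * x * (u ^ 4 * m) + 0"
        by (simp only: eqs)
      also have "\<dots> = u ^ 6 * (x * (x - 1) * (x - m))"
        by (simp add: algebra_simps eval_nat_numeral)
      finally show ?thesis .
    qed
    have inj: "inj_on (\<lambda>x. u ^ 2 * x + r) {0, 1, m}"
      using u by (auto simp: inj_on_def)
    have sub: "(\<lambda>x. u ^ 2 * x + r) ` {0, 1, m} \<subseteq> {0, 1, l}"
      using poly[of 0] poly[of 1] poly[of m] by auto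
    show "(\<lambda>x. u ^ 2 * x + r) ` {0, 1, m} = {0, 1, l}"
    proof (rule card_subset_eq[OF _ sub])
      show "card ((\<lambda>x. u ^ 2 * x + r) ` {0, 1, m}) = card {0, 1, l}"
        unfolding card_image[OF inj] using l m by auto
    qed simp
  next
    fix u r :: 'a
    assume u: "u \<noteq> 0"
    assume img: "(\<lambda>x. u ^ 2 * x + r) ` {0, 1, m} = {0, 1, l}"
    have ne: "r \<noteq> u ^ 2 + r" "r \<noteq> u ^ 2 * m + r" "u ^ 2 + r \<noteq> u ^ 2 * m + r"
      using u m by auto
    have "{r, u ^ 2 + r, u ^ 2 * m + r} = {0, 1, l}"
      using img by simp
    \<comment> \<open>Three distinct elements filling \<open>{0, 1, l}\<close> are 0, 1,
      \<open>l\<close> in some order, so symmetric expressions in them agree. The sum and the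
      pairwise products yield the first two coefficient equations, the cubic evaluated at its root
      \<open>r\<close> yields the third.\<close>
    then have perm: "(\<forall>x. (x - r) * (x - (u ^ 2 + r)) * (x - (u ^ 2 * m + r)) = x * (x - 1) * (x - l))
        \<and> r + (u ^ 2 + r) + (u ^ 2 * m + r) = 1 + l
        \<and> r * (u ^ 2 + r) + r * (u ^ 2 * m + r) + (u ^ 2 + r) * (u ^ 2 * m + r) = l"
      (is "?P r (u ^ 2 + r) (u ^ 2 * m + r)")
    proof -
      have gen: "?P a b c" if "{a, b, c} = {0, 1, l}" "a \<noteq> b" "a \<noteq> c" "b \<noteq> c" for a b c
      proof -
        have "(a = 0 \<and> b = 1 \<and> c = l) \<or> (a = 0 \<and> b = l \<and> c = 1) \<or> (a = 1 \<and> b = 0 \<and> c = l) \<or>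
              (a = 1 \<and> b = l \<and> c = 0) \<or> (a = l \<and> b = 0 \<and> c = 1) \<or> (a = l \<and> b = 1 \<and> c = 0)"
          using that by (smt (verit) insert_iff empty_iff)
        then show ?thesis
          by (elim disjE) (simp_all add: algebra_simps)
      qed
      show "{r, u ^ 2 + r, u ^ 2 * m + r} = {0, 1, l} \<Longrightarrow> ?thesis"
        by (rule gen) (use ne in auto)
    qed
    have p0: "r * (r - 1) * (r - l) = 0"
      using perm[THEN conjunct1, THEN spec, of r] by simp
    have s: "r + (u ^ 2 + r) + (u ^ 2 * m + r) = 1 + l"
       "r * (u ^ 2 + r) + r * (u ^ 2 * m + r) + (u ^ 2 + r) * (u ^ 2 * m + r) = l"
      using perm by auto
    show "u ^ 2 * (- (1 + m)) = - (1 + l) + 3 * r \<and>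
        u ^ 4 * m = l + 2 * r * (- (1 + l)) + 3 * r ^ 2 \<and>
        0 = r * l + r ^ 2 * (- (1 + l)) + r ^ 3"
    proof (intro conjI)
      show "u ^ 2 * (- (1 + m)) = - (1 + l) + 3 * r"
        unfolding s(1)[symmetric] by (simp add: algebra_simps)
      have "l + 2 * r * (- (1 + l)) + 3 * r ^ 2 =
          (r * (u ^ 2 + r) + r * (u ^ 2 * m + r) + (u ^ 2 + r) * (u ^ 2 * m + r))
          + 2 * r * (- (r + (u ^ 2 + r) + (u ^ 2 * m + r))) + 3 * r ^ 2"
        unfolding s ..
      also have "\<dots> = u ^ 4 * m"
        by (simp add: algebra_simps eval_nat_numeral)
      finally show "u ^ 4 * m = l + 2 * r * (- (1 + l)) + 3 * r ^ 2" ..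
      show "0 = r * l + r ^ 2 * (- (1 + l)) + r ^ 3"
        using p0 by (simp add: algebra_simps eval_nat_numeral)
    qed
  qed
  finally show ?thesis .
qed

text \<open>The shift \<open>r\<close> is the image of 0, and \<open>u ^ 2\<close> is the image of 1
  minus that of 0. Each of the six bijections therefore fixes the slope, and the image of
  \<open>m\<close> then determines \<open>m\<close>.\<close>

lemma weierstrass_iso_legendre_iff_class:
  fixes l m :: "'a::field"
  assumes two: "(2 :: 'a) \<noteq> 0" and l: "l \<noteq> 0" "l \<noteq> 1" and m: "m \<noteq> 0" "m \<noteq> 1"
  shows "weierstrass_iso (legendre l) (legendre m) \<longleftrightarrow> m \<in> legendre_class l"
  unfolding weierstrass_iso_legendre_iff[OF assms]
proof
  assume "\<exists>u r. u \<noteq> 0 \<and> (\<lambda>x. u ^ 2 * x + r) ` {0, 1, m} = {0, 1, l}"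
  then obtain u r where u: "u \<noteq> 0" and img: "{r, u ^ 2 + r, u ^ 2 * m + r} = {0, 1, l}"
    by auto
  have ne: "r \<noteq> u ^ 2 + r" "r \<noteq> u ^ 2 * m + r" "u ^ 2 + r \<noteq> u ^ 2 * m + r"
    using u m by auto
  have sq: "is_sq (u ^ 2)"
    by (auto simp: is_sq_def)
  have "(r = 0 \<and> u ^ 2 + r = 1 \<and> u ^ 2 * m + r = l) \<or> (r = 0 \<and> u ^ 2 + r = l \<and> u ^ 2 * m + r = 1) \<or>
        (r = 1 \<and> u ^ 2 + r = 0 \<and> u ^ 2 * m + r = l) \<or> (r = 1 \<and> u ^ 2 + r = l \<and> u ^ 2 * m + r = 0) \<or>
        (r = l \<and> u ^ 2 + r = 0 \<and> u ^ 2 * m + r = 1) \<or> (r = l \<and> u ^ 2 + r = 1 \<and> u ^ 2 * m + r = 0)"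
    using img ne by (smt (verit) insert_iff empty_iff)
  then consider
      "u ^ 2 = 1" "u ^ 2 * m = l" | "u ^ 2 = l" "u ^ 2 * m = 1"
    | "u ^ 2 = - 1" "u ^ 2 * m = l - 1" | "u ^ 2 = l - 1" "u ^ 2 * m = - 1"
    | "u ^ 2 = - l" "u ^ 2 * m = 1 - l" | "u ^ 2 = 1 - l" "u ^ 2 * m = - l"
    by (elim disjE) (auto simp: eq_diff_eq eq_neg_iff_add_eq_0)
  then show "m \<in> legendre_class l"
  proof cases
    case 1 then show ?thesis by (simp add: legendre_class_def)
  next
    case 2
    then have "m = 1 / l" using l by (simp add: field_simps)
    then show ?thesis using 2 sq by (simp add: legendre_class_def)
  next
    case 3
    then have "m = 1 - l" by (simp add: algebra_simps)
    then show ?thesis using 3 sq by (simp add: legendre_class_def)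
  next
    case 4
    then have "m * (1 - l) = 1" by algebra
    then have "m = 1 / (1 - l)" using l by (simp add: nonzero_eq_divide_eq)
    then show ?thesis using 4 sq by (simp add: legendre_class_def)
  next
    case 5
    then have "m = (l - 1) / l" using l by (simp add: field_simps)
    then show ?thesis using 5 sq by (simp add: legendre_class_def)
  next
    case 6
    then have "m * (l - 1) = l" by algebra
    then have "m = l / (l - 1)" using l by (simp add: nonzero_eq_divide_eq)
    then show ?thesis using 6 sq by (simp add: legendre_class_def)
  qed
next
  assume "m \<in> legendre_class l"
  then consider "m = l" | "is_sq (-1 :: 'a)" "m = 1 - l" | "is_sq l" "m = 1 / l"
    | "is_sq (- l)" "m = (l - 1) / l" | "is_sq (l - 1)" "m = 1 / (1 - l)"
    | "is_sq (1 - l)" "m = l / (l - 1)"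
    unfolding legendre_class_def by blast
  \<comment> \<open>The witnesses are the slope \<open>v\<close> and the image \<open>r\<close> of 0
    in each of the six bijections. A square root of the nonzero \<open>v\<close> provides
    \<open>u\<close> afterwards.\<close>
  then have "\<exists>v r. is_sq v \<and> v \<noteq> 0 \<and> (\<lambda>x. v * x + r) ` {0, 1, m} = {0, 1, l}"
  proof cases
    case 1 then show ?thesis by (intro exI[of _ 1] exI[of _ 0]) auto
  next
    case 2 then show ?thesis by (intro exI[of _ "-1"] exI[of _ 1]) auto
  next
    case 3 then show ?thesis using l by (intro exI[of _ l] exI[of _ 0]) auto
  next
    case 4 then show ?thesis using l by (intro exI[of _ "-l"] exI[of _ l]) auto
  next
    case 5
    have "(l - 1) * (1 / (1 - l)) = -1" using l by (simp add: field_simps)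
    then show ?thesis using 5 l by (intro exI[of _ "l-1"] exI[of _ 1]) auto
  next
    case 6
    have "(1 - l) * (l / (l - 1)) = -l" using l by (simp add: field_simps)
    then show ?thesis using 6 l by (intro exI[of _ "1-l"] exI[of _ l]) auto
  qed
  then show "\<exists>u r. u \<noteq> 0 \<and> (\<lambda>x. u ^ 2 * x + r) ` {0, 1, m} = {0, 1, l}"
    unfolding is_sq_def by (metis zero_power2)
qed

lemma legendre_class_subset:
  "l \<in> legendre_params \<Longrightarrow> legendre_class l \<subseteq> legendre_params"
  by (auto simp: legendre_class_def legendre_params_def field_simps split: if_splits)

lemma legendre_curves_eq: "legendre_curves = legendre ` legendre_params"
  by (auto simp: legendre_curves_def legendre_params_def)

lemma inj_legendre: "inj legendre"
  by (auto simp: inj_def legendre_def)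

text \<open>Affine maps with nonzero square slope form a group under composition. Identity, inverses
  and composites give reflexivity, symmetry and transitivity.\<close>

lemma equiv_legendre_iso:
  assumes two: "(2 :: 'a) \<noteq> 0"
  shows "equiv (legendre_curves :: 'a::field weierstrass set)
    {(E, E'). E \<in> legendre_curves \<and> E' \<in> legendre_curves \<and> weierstrass_iso E E'}"
proof -
  have iff: "weierstrass_iso (legendre l) (legendre m) \<longleftrightarrow>
      (\<exists>u r. u \<noteq> 0 \<and> (\<lambda>x. u ^ 2 * x + r) ` {0, 1, m} = {0, 1, l})"
    if "l \<in> legendre_params" "m \<in> legendre_params" for l m :: 'a
    using that weierstrass_iso_legendre_iff[OF two, of l m] unfolding legendre_params_def by blast
  have r: "weierstrass_iso (legendre l) (legendre l)" if "l \<in> legendre_params" for l :: 'a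
    unfolding iff[OF that that] by (rule exI[of _ 1], rule exI[of _ 0]) simp
  have s: "weierstrass_iso (legendre m) (legendre l)"
    if lm: "l \<in> legendre_params" "m \<in> legendre_params" and iso: "weierstrass_iso (legendre l) (legendre m)"
    for l m :: 'a
  proof -
    obtain u r where u: "u \<noteq> 0" and img: "(\<lambda>x. u ^ 2 * x + r) ` {0, 1, m} = {0, 1, l}"
      using iso unfolding iff[OF lm] by blast
    have "(1 / u) ^ 2 * (u ^ 2 * x + r) + (- r / u ^ 2) = x" for x
      using u by (simp add: field_simps)
    then have "(\<lambda>x. (1 / u) ^ 2 * x + (- r / u ^ 2)) ` (\<lambda>x. u ^ 2 * x + r) ` {0, 1, m} = {0, 1, m}"
      unfolding image_image by simp
    moreover have "1 / u \<noteq> 0" using u by simp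
    ultimately show ?thesis
      unfolding iff[OF lm(2,1)] img by blast
  qed
  have t: "weierstrass_iso (legendre l) (legendre n)"
    if lm: "l \<in> legendre_params" "m \<in> legendre_params" "n \<in> legendre_params"
      and iso: "weierstrass_iso (legendre l) (legendre m)" "weierstrass_iso (legendre m) (legendre n)"
    for l m n :: 'a
  proof -
    obtain u r where u: "u \<noteq> 0" and img: "(\<lambda>x. u ^ 2 * x + r) ` {0, 1, m} = {0, 1, l}"
      using iso(1) unfolding iff[OF lm(1,2)] by blast
    obtain v s where v: "v \<noteq> 0" and img': "(\<lambda>x. v ^ 2 * x + s) ` {0, 1, n} = {0, 1, m}"
      using iso(2) unfolding iff[OF lm(2,3)] by blast
    have "(\<lambda>x. u ^ 2 * x + r) ` (\<lambda>x. v ^ 2 * x + s) ` {0, 1, n} = {0, 1, l}"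
      by (simp only: img img')
    moreover have "u ^ 2 * (v ^ 2 * x + s) + r = (u * v) ^ 2 * x + (u ^ 2 * s + r)" for x
      by (simp add: algebra_simps)
    ultimately have "(\<lambda>x. (u * v) ^ 2 * x + (u ^ 2 * s + r)) ` {0, 1, n} = {0, 1, l}"
      by (simp only: image_image)
    moreover have "u * v \<noteq> 0" using u v by simp
    ultimately show ?thesis
      unfolding iff[OF lm(1,3)] by blast
  qed
  show ?thesis
    unfolding legendre_curves_eq
  proof (rule equivI)
    let ?R = "{(E, E'). E \<in> legendre ` legendre_params \<and> E' \<in> legendre ` legendre_params \<and>
      weierstrass_iso E E'} :: 'a weierstrass rel"
    show "?R \<subseteq> legendre ` legendre_params \<times> legendre ` legendre_params" by blast
    show "refl_on (legendre ` legendre_params) ?R"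
      using r by (auto simp: refl_on_def)
    show "sym ?R"
      using s by (auto simp: sym_def)
    show "trans ?R"
    proof (rule transI)
      fix A B C assume "(A, B) \<in> ?R" "(B, C) \<in> ?R"
      then obtain l m n where "A = legendre l" "B = legendre m" "C = legendre n"
          "l \<in> legendre_params" "m \<in> legendre_params" "n \<in> legendre_params"
          "weierstrass_iso A B" "weierstrass_iso B C" by auto
      then show "(A, C) \<in> ?R" using t[of l m n] by simp
    qed
  qed
qed

text \<open>This moves the weighted count from curves to parameters: \<open>legendre\<close> is
  injective and carries \<open>legendre_class l\<close> onto the isomorphism class of
  \<open>legendre l\<close>.\<close>

lemma card_legendre_classes:
  assumes two: "(2 :: 'a) \<noteq> 0"
  shows "real (card (legendre_classes :: 'a::{field, finite} weierstrass set set)) =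
    (\<Sum>l\<in>(legendre_params :: 'a set). 1 / real (card (legendre_class l)))"
proof -
  let ?R = "{(E, E'). E \<in> legendre_curves \<and> E' \<in> legendre_curves \<and> weierstrass_iso E E'} :: 'a weierstrass rel"
  have fin: "finite (legendre_curves :: 'a weierstrass set)"
    by (simp add: legendre_curves_eq)
  have cl: "card (?R `` {legendre l}) = card (legendre_class l)" if l: "l \<in> legendre_params" for l :: 'a
  proof -
    have "?R `` {legendre l} = legendre ` {m \<in> legendre_params. weierstrass_iso (legendre l) (legendre m)}"
      using l by (auto simp: legendre_curves_eq)
    also have "{m \<in> legendre_params. weierstrass_iso (legendre l) (legendre m)} = legendre_class l"
    proof (rule set_eqI)
      fix m
      show "m \<in> {m \<in> legendre_params. weierstrass_iso (legendre l) (legendre m)} \<longleftrightarrow> m \<in> legendre_class l"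
        using l legendre_class_subset[OF l] weierstrass_iso_legendre_iff_class[OF two, of l m]
        by (cases "m \<in> legendre_params") (auto simp: legendre_params_def)
    qed
    finally have "?R `` {legendre l} = legendre ` legendre_class l" .
    then show ?thesis
      by (simp add: card_image inj_on_subset[OF inj_legendre])
  qed
  have "real (card (legendre_classes :: 'a weierstrass set set)) =
      (\<Sum>E\<in>legendre ` (legendre_params :: 'a set). 1 / real (card (?R `` {E})))"
    unfolding legendre_classes_def card_quotient_sum[OF fin equiv_legendre_iso[OF two]]
    by (rule sum.cong) (simp_all only: legendre_curves_eq)
  also have "\<dots> = (\<Sum>l\<in>(legendre_params :: 'a set). 1 / real (card (?R `` {legendre l})))"
    by (subst sum.reindex[OF inj_on_subset[OF inj_legendre]]) (simp_all only: subset_UNIV o_def)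
  also have "\<dots> = (\<Sum>l\<in>(legendre_params :: 'a set). 1 / real (card (legendre_class l)))"
    by (rule sum.cong[OF refl]) (simp only: cl)
  finally show ?thesis .
qed

section \<open>Squares in finite fields of odd characteristic\<close>

lemma is_sq_mult: "is_sq x \<Longrightarrow> is_sq y \<Longrightarrow> is_sq (x * y)"
  unfolding is_sq_def by (metis power_mult_distrib)

lemma is_sq_mult_power2_iff: "y \<noteq> 0 \<Longrightarrow> is_sq (y ^ 2 * x) \<longleftrightarrow> is_sq x"
proof
  assume "y \<noteq> 0" "is_sq (y ^ 2 * x)"
  then show "is_sq x"
    using is_sq_mult[OF _ is_sq_power2, of "y ^ 2 * x" "1 / y"] by (simp add: power_divide)
qed (simp add: is_sq_mult)

text \<open>Squaring is two-to-one on the nonzero elements, because \<open>z\<close> and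
  \<open>- z\<close> differ when 2 is invertible.\<close>

lemma card_nonzero_squares:
  assumes two: "(2 :: 'a::{field, finite}) \<noteq> 0"
  shows "2 * card {x :: 'a. x \<noteq> 0 \<and> is_sq x} + 1 = CARD('a)"
proof -
  let ?U = "UNIV - {0 :: 'a}"
  have img: "(\<lambda>x. x ^ 2) ` ?U = {x. x \<noteq> 0 \<and> is_sq x}"
    by (auto simp: is_sq_def)
  have "card ?U = (\<Sum>y\<in>(\<lambda>x. x ^ 2) ` ?U. card {x \<in> ?U. x ^ 2 = y})"
    using sum.image_gen[of ?U "\<lambda>_. 1 :: nat" "\<lambda>x. x ^ 2"] by simp
  also have "\<dots> = (\<Sum>y\<in>(\<lambda>x. x ^ 2) ` ?U. 2)"
  proof (rule sum.cong[OF refl])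
    fix y assume "y \<in> (\<lambda>x. x ^ 2) ` ?U"
    then obtain z where z: "z \<noteq> 0" "y = z ^ 2" by auto
    have "z \<noteq> - z"
      using two z by (metis add_eq_0_iff mult_2 mult_eq_0_iff)
    moreover have "{x \<in> ?U. x ^ 2 = y} = {z, - z}"
      using z by (auto simp: power2_eq_iff)
    ultimately show "card {x \<in> ?U. x ^ 2 = y} = 2" by simp
  qed
  finally have "card ?U = 2 * card {x :: 'a. x \<noteq> 0 \<and> is_sq x}"
    unfolding img by simp
  \<comment> \<open>Removing 0 gives the truncated difference \<open>CARD('a) - 1\<close>;
    positivity makes adding 1 undo it.\<close>
  moreover have "CARD('a) > 0" by (simp add: card_gt_0_iff)
  ultimately show ?thesis by (simp only: card_Diff_singleton[OF UNIV_I])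
qed

text \<open>Multiplication by the nonsquare \<open>x\<close> injects the nonzero squares into the
  nonsquares. Both sets have the same size, so the map is onto: \<open>y = s * x\<close> with
  \<open>s\<close> a square, and \<open>x * y = x ^ 2 * s\<close>.\<close>

lemma is_sq_mult_nonsq:
  fixes x y :: "'a::{field, finite}"
  assumes two: "(2 :: 'a) \<noteq> 0" and x: "\<not> is_sq x" and y: "\<not> is_sq y"
  shows "is_sq (x * y)"
proof -
  let ?Q = "{z :: 'a. z \<noteq> 0 \<and> is_sq z}" and ?N = "{z :: 'a. \<not> is_sq z}"
  have z0: "is_sq (0 :: 'a)" unfolding is_sq_def by (intro exI[of _ 0]) simp
  then have x0: "x \<noteq> 0" using x by auto
  have "CARD('a) = card (insert 0 ?Q \<union> ?N)"
    by (rule arg_cong[where f = card]) auto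
  also have "\<dots> = card (insert 0 ?Q) + card ?N"
    using z0 by (intro card_Un_disjoint) auto
  finally have cardN: "card ?N = card ?Q"
    using card_nonzero_squares[OF two] by simp
  have sub: "(\<lambda>s. s * x) ` ?Q \<subseteq> ?N"
  proof (intro image_subsetI CollectI)
    fix s :: 'a assume "s \<in> ?Q"
    then obtain y where "s = y ^ 2" "y \<noteq> 0" by (auto simp: is_sq_def)
    then show "\<not> is_sq (s * x)" using x by (simp add: is_sq_mult_power2_iff)
  qed
  have inj: "inj_on (\<lambda>s. s * x) ?Q"
    using x0 by (auto simp: inj_on_def)
  have "(\<lambda>s. s * x) ` ?Q = ?N"
    by (rule card_subset_eq) (simp_all add: sub card_image[OF inj] cardN)
  then obtain s where "is_sq s" "y = s * x"
    using y by blast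
  then have "x * y = x ^ 2 * s" by (simp add: power2_eq_square)
  then show ?thesis
    using \<open>is_sq s\<close> by (simp add: is_sq_mult)
qed

lemma is_sq_mult_iff:
  fixes x y :: "'a::{field, finite}"
  assumes two: "(2 :: 'a) \<noteq> 0" and "x \<noteq> 0" "y \<noteq> 0"
  shows "is_sq (x * y) \<longleftrightarrow> (is_sq x \<longleftrightarrow> is_sq y)"
proof -
  have *: "\<not> is_sq (a * b)" if "is_sq a" "\<not> is_sq b" "a \<noteq> 0" for a b :: 'a
    using that is_sq_mult_power2_iff[of _ b] by (auto simp: is_sq_def)
  show ?thesis
    using *[of x y] *[of y x] is_sq_mult[of x y] is_sq_mult_nonsq[OF two, of x y] assms(2,3)
    by (auto simp: mult.commute)
qed

text \<open>These are the sums from which the total of the class weights is assembled, since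
  generically the weight is a linear combination of these indicators and a constant.\<close>

lemma sum_is_sq_params:
  assumes two: "(2 :: 'a::{field, finite}) \<noteq> 0"
  shows "(\<Sum>l\<in>(legendre_params :: 'a set). of_bool (is_sq l)) = (real CARD('a) - 3) / 2"
    and "(\<Sum>l\<in>(legendre_params :: 'a set). of_bool (is_sq (1 - l))) = (real CARD('a) - 3) / 2"
    and "(\<Sum>l\<in>(legendre_params :: 'a set). of_bool (is_sq l \<and> is_sq (1 - l))) =
           (real CARD('a) - (if is_sq (- 1 :: 'a) then 5 else 3)) / 4"
    and "real (card (legendre_params :: 'a set)) = real CARD('a) - 2"
proof -
  let ?P = "legendre_params :: 'a set" and ?Q = "{x :: 'a. x \<noteq> 0 \<and> is_sq x}"
  have q: "2 * real (card ?Q) + 1 = real CARD('a)"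
    using card_nonzero_squares[OF two] by linarith
  have one: "is_sq (1 :: 'a)"
    using is_sq_power2[of "1 :: 'a"] by simp
  have P: "?P = UNIV - {0, 1}"
    by (auto simp: legendre_params_def)
  have "CARD('a) \<ge> card {0, 1 :: 'a}" by (rule card_mono) auto
  then show p: "real (card ?P) = real CARD('a) - 2"
    unfolding P by (subst card_Diff_subset) auto
  have "card ?Q > 0" using one by (auto simp: card_gt_0_iff intro!: exI[of _ 1])
  have Q1: "real (card (?Q - {c})) = real (card ?Q) - of_bool (c \<in> ?Q)" for c
    using \<open>card ?Q > 0\<close> by (auto simp: card_Diff_singleton_if)
  have sumcard: "(\<Sum>l\<in>?P. of_bool (R l)) = real (card {l \<in> ?P. R l})" for R
    by (simp add: Int_def)
  have eqa: "{l \<in> ?P. is_sq l} = ?Q - {1}"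
    by (auto simp: legendre_params_def)
  show a: "(\<Sum>l\<in>?P. of_bool (is_sq l)) = (real CARD('a) - 3) / 2"
    unfolding sumcard eqa Q1 using q one by simp
  have "(\<Sum>l\<in>?P. of_bool (is_sq (1 - l))) = (\<Sum>l\<in>?P. of_bool (is_sq l) :: real)"
    by (rule sum.reindex_bij_witness[of _ "\<lambda>l. 1 - l" "\<lambda>l. 1 - l"]) (auto simp: legendre_params_def)
  with a show b: "(\<Sum>l\<in>?P. of_bool (is_sq (1 - l))) = (real CARD('a) - 3) / 2"
    by simp
  \<comment> \<open>Under the shift \<open>l = x + 1\<close> the excluded value \<open>l = 1\<close>
    is \<open>x = 0\<close>, already absent from the nonzero squares, and \<open>l = 0\<close> is
    \<open>x = - 1\<close>, which must be removed.\<close>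
  have eqc: "{l \<in> ?P. is_sq (l - 1)} = (\<lambda>x. x + 1) ` (?Q - {- 1})"
  proof (intro equalityI subsetI)
    fix l assume "l \<in> {l \<in> ?P. is_sq (l - 1)}"
    then show "l \<in> (\<lambda>x. x + 1) ` (?Q - {- 1})"
      by (intro image_eqI[of _ _ "l - 1"]) (auto simp: legendre_params_def algebra_simps)
  qed (auto simp: legendre_params_def add_eq_0_iff minus_equation_iff[of _ 1])
  \<comment> \<open>\<open>l (1 - l) = l\<^sup>2 (1/l - 1)\<close>, so the inversion of \<open>l\<close> turns a quadratic condition into a linear one.\<close>
  have "(\<Sum>l\<in>?P. of_bool (is_sq (l * (1 - l)))) = (\<Sum>l\<in>?P. of_bool (is_sq (l - 1)) :: real)"
  proof (rule sum.reindex_bij_witness[of _ "\<lambda>l. 1 / l" "\<lambda>l. 1 / l"])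
    fix l assume l: "l \<in> ?P"
    then have "l * (1 - l) = l ^ 2 * (1 / l - 1)"
      by (simp add: legendre_params_def field_simps power2_eq_square)
    then show "of_bool (is_sq (1 / l - 1)) = (of_bool (is_sq (l * (1 - l))) :: real)"
      using l is_sq_mult_power2_iff[of l] by (simp add: legendre_params_def)
  qed (auto simp: legendre_params_def)
  also have "\<dots> = real (card ?Q) - of_bool (is_sq (- 1 :: 'a))"
    unfolding sumcard eqc by (subst card_image) (simp_all add: Q1)
  finally have c: "(\<Sum>l\<in>?P. of_bool (is_sq (l * (1 - l)))) = real (card ?Q) - of_bool (is_sq (- 1 :: 'a))" .
  \<comment> \<open>The product is a square iff both factors or neither are. With indicators a and b
    this is 1 - a - b + 2ab, which is solved for the sum of ab.\<close>
  have "(\<Sum>l\<in>?P. of_bool (is_sq (l * (1 - l))) :: real) =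
      (\<Sum>l\<in>?P. 1 - of_bool (is_sq l) - of_bool (is_sq (1 - l)) + 2 * of_bool (is_sq l \<and> is_sq (1 - l)))"
    by (rule sum.cong) (auto simp: legendre_params_def is_sq_mult_iff[OF two])
  also have "\<dots> = real CARD('a) - 2 - (real CARD('a) - 3) / 2 - (real CARD('a) - 3) / 2
      + 2 * (\<Sum>l\<in>?P. of_bool (is_sq l \<and> is_sq (1 - l)))"
    unfolding sum.distrib sum_subtractf a b p[symmetric] by (simp add: sum_distrib_left)
  finally show "(\<Sum>l\<in>?P. of_bool (is_sq l \<and> is_sq (1 - l))) =
           (real CARD('a) - (if is_sq (- 1 :: 'a) then 5 else 3)) / 4"
    unfolding c using q by (cases "is_sq (- 1 :: 'a)") (simp_all add: field_simps)
qed

section \<open>Coincidences among the six cross ratios\<close>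

lemma cross_ratio_eq_iffs:
  fixes l :: "'a::field"
  assumes "l \<noteq> 0" "l \<noteq> 1"
  shows "1 - l = l \<longleftrightarrow> 2 * l = 1" and "1 / l = l \<longleftrightarrow> l = - 1"
    and "(l - 1) / l = l \<longleftrightarrow> l ^ 2 - l + 1 = 0" and "1 / (1 - l) = l \<longleftrightarrow> l ^ 2 - l + 1 = 0"
    and "l / (l - 1) = l \<longleftrightarrow> l = 2" and "1 / l = 1 - l \<longleftrightarrow> l ^ 2 - l + 1 = 0"
    and "(l - 1) / l = 1 - l \<longleftrightarrow> l = - 1" and "1 / (1 - l) = 1 - l \<longleftrightarrow> l = 2"
    and "l / (l - 1) = 1 - l \<longleftrightarrow> l ^ 2 - l + 1 = 0" and "1 / l = (l - 1) / l \<longleftrightarrow> l = 2"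
    and "1 / l = 1 / (1 - l) \<longleftrightarrow> 2 * l = 1" and "1 / l = l / (l - 1) \<longleftrightarrow> l ^ 2 - l + 1 = 0"
    and "(l - 1) / l = 1 / (1 - l) \<longleftrightarrow> l ^ 2 - l + 1 = 0" and "(l - 1) / l = l / (l - 1) \<longleftrightarrow> 2 * l = 1"
    and "1 / (1 - l) = l / (l - 1) \<longleftrightarrow> l = - 1"
proof -
  \<comment> \<open>Two cross ratios agree exactly when \<open>l\<close> is fixed by a nontrivial
    element of the group of the six maps: the involutions account for \<open>- 1\<close>, 2 and 1/2,
    the two maps of order three for the roots of \<open>l ^ 2 - l + 1\<close>. Each equality is
    cleared of denominators, and factors \<open>l\<close> or \<open>l - 1\<close> are
    cancelled.\<close>
  have eq: "a / b = c / d \<longleftrightarrow> a * d - b * c = 0" if "b \<noteq> 0" "d \<noteq> 0" for a b c d :: 'a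
    using that by (auto simp: frac_eq_eq algebra_simps)
  have eq1: "a / b = c \<longleftrightarrow> a - b * c = 0" if "b \<noteq> 0" for a b c :: 'a
    using that by (auto simp: field_simps)
  have nz: "1 - l \<noteq> 0" "l - 1 \<noteq> 0" using assms by auto
  have sq: "a * b = 0 \<longleftrightarrow> b = 0" if "a \<noteq> 0" for a b :: 'a using that by simp
  show "1 - l = l \<longleftrightarrow> 2 * l = 1" by (auto simp: algebra_simps)
  have "1 / l = l \<longleftrightarrow> (1 - l) * (l + 1) = 0"
    unfolding eq1[OF assms(1)] by (simp add: algebra_simps)
  also have "\<dots> \<longleftrightarrow> l = - 1" unfolding sq[OF nz(1)] by (rule add_eq_0_iff2)
  finally show "1 / l = l \<longleftrightarrow> l = - 1" .
  have "(l - 1) / l = l \<longleftrightarrow> - (l ^ 2 - l + 1) = 0"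
    unfolding eq1[OF assms(1)] by (simp add: algebra_simps power2_eq_square)
  then show "(l - 1) / l = l \<longleftrightarrow> l ^ 2 - l + 1 = 0" unfolding neg_equal_0_iff_equal .
  show "1 / (1 - l) = l \<longleftrightarrow> l ^ 2 - l + 1 = 0"
    unfolding eq1[OF nz(1)] by (simp add: algebra_simps power2_eq_square)
  have "l / (l - 1) = l \<longleftrightarrow> l * (2 - l) = 0"
    unfolding eq1[OF nz(2)] by (simp add: algebra_simps)
  then show "l / (l - 1) = l \<longleftrightarrow> l = 2" unfolding sq[OF assms(1)] by auto
  show "1 / l = 1 - l \<longleftrightarrow> l ^ 2 - l + 1 = 0"
    unfolding eq1[OF assms(1)] by (simp add: algebra_simps power2_eq_square)
  have "(l - 1) / l = 1 - l \<longleftrightarrow> (l - 1) * (l + 1) = 0"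
    unfolding eq1[OF assms(1)] by (simp add: algebra_simps)
  also have "\<dots> \<longleftrightarrow> l = - 1" unfolding sq[OF nz(2)] by (rule add_eq_0_iff2)
  finally show "(l - 1) / l = 1 - l \<longleftrightarrow> l = - 1" .
  have "1 / (1 - l) = 1 - l \<longleftrightarrow> l * (2 - l) = 0"
    unfolding eq1[OF nz(1)] by (simp add: algebra_simps)
  then show "1 / (1 - l) = 1 - l \<longleftrightarrow> l = 2" unfolding sq[OF assms(1)] by auto
  show "l / (l - 1) = 1 - l \<longleftrightarrow> l ^ 2 - l + 1 = 0"
    unfolding eq1[OF nz(2)] by (simp add: algebra_simps power2_eq_square)
  have "1 / l = (l - 1) / l \<longleftrightarrow> l * (2 - l) = 0"
    unfolding eq[OF assms(1) assms(1)] by (simp add: algebra_simps)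
  then show "1 / l = (l - 1) / l \<longleftrightarrow> l = 2" unfolding sq[OF assms(1)] by auto
  have "1 / l = 1 / (1 - l) \<longleftrightarrow> 1 - 2 * l = 0"
    unfolding eq[OF assms(1) nz(1)] by (simp add: algebra_simps)
  then show "1 / l = 1 / (1 - l) \<longleftrightarrow> 2 * l = 1" by auto
  have "1 / l = l / (l - 1) \<longleftrightarrow> - (l ^ 2 - l + 1) = 0"
    unfolding eq[OF assms(1) nz(2)] by (simp add: algebra_simps power2_eq_square)
  then show "1 / l = l / (l - 1) \<longleftrightarrow> l ^ 2 - l + 1 = 0" unfolding neg_equal_0_iff_equal .
  have "(l - 1) / l = 1 / (1 - l) \<longleftrightarrow> - (l ^ 2 - l + 1) = 0"
    unfolding eq[OF assms(1) nz(1)] by (simp add: algebra_simps power2_eq_square)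
  then show "(l - 1) / l = 1 / (1 - l) \<longleftrightarrow> l ^ 2 - l + 1 = 0" unfolding neg_equal_0_iff_equal .
  have "(l - 1) / l = l / (l - 1) \<longleftrightarrow> 1 - 2 * l = 0"
    unfolding eq[OF assms(1) nz(2)] by (simp add: algebra_simps)
  then show "(l - 1) / l = l / (l - 1) \<longleftrightarrow> 2 * l = 1" by auto
  have "1 / (1 - l) = l / (l - 1) \<longleftrightarrow> (l - 1) * (l + 1) = 0"
    unfolding eq[OF nz] by (simp add: algebra_simps)
  also have "\<dots> \<longleftrightarrow> l = - 1" unfolding sq[OF nz(2)] by (rule add_eq_0_iff2)
  finally show "1 / (1 - l) = l / (l - 1) \<longleftrightarrow> l = - 1" .
qed

section \<open>Sizes of the isomorphism classes\<close>

lemma is_sq_minus_iff: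
  assumes "is_sq (- 1 :: 'a::field)"
  shows "is_sq (- x :: 'a) \<longleftrightarrow> is_sq x"
  using is_sq_mult[OF assms, of x] is_sq_mult[OF assms, of "- x"] by auto

text \<open>Such an \<open>l\<close> satisfies \<open>l ^ 3 = - 1\<close>, so \<open>- l\<close> is
  the fourth power of \<open>l\<close>, and \<open>l - 1\<close> is its square.\<close>

lemma sixth_root_minus_sq:
  fixes l :: "'a::field"
  assumes "l ^ 2 - l + 1 = 0"
  shows "is_sq (- l)" and "is_sq (l - 1)"
proof -
  have l2: "l - 1 = l ^ 2"
    using assms by (simp add: algebra_simps)
  show "is_sq (l - 1)"
    unfolding l2 by simp
  have "(l ^ 2) ^ 2 = (l - 1) ^ 2" by (simp only: l2)
  also have "\<dots> = l ^ 2 - l + 1 - l" by (simp add: power2_eq_square algebra_simps)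
  also have "\<dots> = - l" unfolding assms by simp
  finally show "is_sq (- l)" using is_sq_power2[of "l ^ 2"] by simp
qed

text \<open>Exactly one of \<open>l\<close>, \<open>- l\<close> and one of \<open>l - 1\<close>,
  \<open>1 - l\<close> is a square, so besides \<open>l\<close> the class holds one cross ratio from
  each of two pairs. The size is three, except at the roots of \<open>l ^ 2 - l + 1\<close>, where
  both choices equal \<open>l\<close>.\<close>

lemma card_legendre_class_nonsq:
  fixes l :: "'a::{field, finite}"
  assumes two: "(2 :: 'a) \<noteq> 0" and m1: "\<not> is_sq (- 1 :: 'a)" and l: "l \<in> legendre_params"
  shows "1 / real (card (legendre_class l)) = 1 / 3 + 2 / 3 * of_bool (l ^ 2 - l + 1 = 0)"
proof -
  have l0: "l \<noteq> 0" "l \<noteq> 1" using l by (auto simp: legendre_params_def)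
  note iffs = cross_ratio_eq_iffs[OF l0]
  have neg: "is_sq (- x) \<longleftrightarrow> \<not> is_sq x" if "x \<noteq> 0" for x :: 'a
    using is_sq_mult_iff[OF two, of "- 1" x] m1 that by simp
  have a: "is_sq (- l) \<longleftrightarrow> \<not> is_sq l" using neg l0 by simp
  have b: "is_sq (1 - l) \<longleftrightarrow> \<not> is_sq (l - 1)" using neg[of "l - 1"] l0 by simp
  show ?thesis
  proof (cases "l ^ 2 - l + 1 = 0")
    case True
    have "legendre_class l = {l}"
      using m1 a b sixth_root_minus_sq[OF True]
      unfolding legendre_class_def iffs(3)[THEN iffD2, OF True] iffs(4)[THEN iffD2, OF True] by blast
    then show ?thesis using True by simp
  next
    case False
    have nm1: "l \<noteq> - 1" if "is_sq l" using that m1 by auto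
    have n2: "l \<noteq> 2" if "is_sq (1 - l)" using that m1 by auto
    have half: "2 * l \<noteq> 1" if "is_sq l \<longleftrightarrow> is_sq (l - 1)"
      using that b iffs(1) by metis
    have "legendre_class l =
       {l, if is_sq l then 1 / l else (l - 1) / l, if is_sq (l - 1) then 1 / (1 - l) else l / (l - 1)}"
      using m1 a b unfolding legendre_class_def by (auto simp only: split: if_splits)
    moreover have "card \<dots> = 3"
    proof -
      have card3: "card {x, y, z} = 3" if "y \<noteq> x" "z \<noteq> x" "y \<noteq> z" for x y z :: 'a
        using that by auto
      show ?thesis
      proof (rule card3)
        show "(if is_sq l then 1 / l else (l - 1) / l) \<noteq> l"
          using False nm1 by (auto simp only: iffs split: if_splits)
        show "(if is_sq (l - 1) then 1 / (1 - l) else l / (l - 1)) \<noteq> l"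
          using False n2 b by (auto simp only: iffs split: if_splits)
        show "(if is_sq l then 1 / l else (l - 1) / l) \<noteq> (if is_sq (l - 1) then 1 / (1 - l) else l / (l - 1))"
          using False half by (auto simp only: iffs split: if_splits)
      qed
    qed
    ultimately show ?thesis using False by simp
  qed
qed

text \<open>The order of the list makes each required inequality an instance of
  \<open>cross_ratio_eq_iffs\<close> in its stated orientation.\<close>

lemma card_pairs:
  assumes "distinct [c, d, e, f, b, a]"
  shows "card ({a, b} \<union> (if P then {c, d} else {}) \<union> (if Q then {e, f} else {})) =
    2 + 2 * of_bool P + 2 * of_bool Q"
  using assms by auto

text \<open>The generic size is 2 + 2a + 2b with a, b the indicators of \<open>is_sq l\<close> and
  \<open>is_sq (1 - l)\<close>; its reciprocal is interpolated by 1/2 - a/4 - b/4 + ab/6. The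
  remaining terms are the true reciprocal minus this value at the exceptional parameters.\<close>

lemma card_legendre_class_sq:
  fixes l :: "'a::{field, finite}"
  assumes two: "(2 :: 'a) \<noteq> 0" and three: "(3 :: 'a) \<noteq> 0"
    and m1: "is_sq (- 1 :: 'a)" and l: "l \<in> legendre_params"
  shows "1 / real (card (legendre_class l)) =
    1 / 2 - of_bool (is_sq l) / 4 - of_bool (is_sq (1 - l)) / 4 + of_bool (is_sq l \<and> is_sq (1 - l)) / 6
    + of_bool (l ^ 2 - l + 1 = 0) / 3
    + of_bool (l = - 1) * (if is_sq (2 :: 'a) then 1 / 6 else 1 / 4)
    + of_bool (l = 2) * (if is_sq (2 :: 'a) then 1 / 6 else 1 / 4)
    + of_bool (l = 1 / 2) * (if is_sq (2 :: 'a) then 1 / 6 else 1 / 2)"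
proof -
  have l0: "l \<noteq> 0" "l \<noteq> 1" using l by (auto simp: legendre_params_def)
  note iffs = cross_ratio_eq_iffs[OF l0]
  have half: "2 * x = 1 \<longleftrightarrow> x = 1 / 2" for x :: 'a
    using two by (auto simp: field_simps)
  \<comment> \<open>Any two of -1, 2, 1/2 coincide only if 3 = 0, and \<open>l ^ 2 - l + 1\<close>
    takes the values 3, 3 and 3/4 there. So the exceptional cases are disjoint.\<close>
  have "(2 :: 'a) + 1 = 3" "(4 :: 'a) - 1 = 3" by simp_all
  then have m12: "(- 1 :: 'a) \<noteq> 2" "(2 :: 'a) \<noteq> - 1" and four: "(4 :: 'a) \<noteq> 1" "1 \<noteq> (4 :: 'a)"
    using three by (metis add.left_inverse, metis add.left_inverse, metis diff_self, metis diff_self)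
  have m1h: "(- 1 :: 'a) \<noteq> 1 / 2" "(1 / 2 :: 'a) \<noteq> - 1"
    using three two by (auto simp: field_simps)
  have h2: "(2 :: 'a) \<noteq> 1 / 2" "(1 / 2 :: 'a) \<noteq> 2"
    using four two by (auto simp: field_simps)
  have "(4 :: 'a) * (x ^ 2 - x + 1) = (2 * x) ^ 2 - 2 * (2 * x) + 4" for x
    by (simp add: algebra_simps power2_eq_square)
  from this[of "1 / 2"] have "(4 :: 'a) * ((1 / 2) ^ 2 - 1 / 2 + 1) = 3"
    using two by simp
  then have W: "(- 1 :: 'a) ^ 2 - (- 1) + 1 \<noteq> 0" "(2 :: 'a) ^ 2 - 2 + 1 \<noteq> 0" "(1 / 2 :: 'a) ^ 2 - 1 / 2 + 1 \<noteq> 0"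
    using three by (simp, simp, metis mult_zero_right)
  have card_special: "card {- 1, 2 :: 'a} = 2" "card {- 1, 2, 1 / 2 :: 'a} = 3" "card {1 / 2, - 1, 2 :: 'a} = 3"
    using card_insert_disjoint[of "{2 :: 'a}" "- 1"] card_insert_disjoint[of "{2, 1 / 2 :: 'a}" "- 1"]
      card_insert_disjoint[of "{1 / 2 :: 'a}" 2] m12 m1h h2 by (simp_all add: insert_commute)
  have sqhalf: "is_sq (1 / 2 :: 'a) \<longleftrightarrow> is_sq (2 :: 'a)"
  proof -
    have "(2 :: 'a) ^ 2 * (1 / 2) = 2 * (2 * (1 / 2))" by (simp only: power2_eq_square mult.assoc)
    also have "\<dots> = 2" using two by simp
    finally have e: "(2 :: 'a) ^ 2 * (1 / 2) = 2" .
    show ?thesis using is_sq_mult_power2_iff[OF two, of "1 / 2"] unfolding e by blast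
  qed
  \<comment> \<open>Since -1 is a square, signs do not affect squareness, and the six cross ratios
    group into three pairs with a common condition each.\<close>
  have cl: "legendre_class l = {l, 1 - l} \<union> (if is_sq l then {1 / l, (l - 1) / l} else {})
     \<union> (if is_sq (1 - l) then {1 / (1 - l), l / (l - 1)} else {})"
    using m1 is_sq_minus_iff[OF m1, of l] is_sq_minus_iff[OF m1, of "1 - l"]
    unfolding legendre_class_def minus_diff_eq by (auto simp only: split: if_splits)
  consider "l ^ 2 - l + 1 = 0" | "l = - 1" | "l = 2" | "l = 1 / 2"
    | "l ^ 2 - l + 1 \<noteq> 0" "l \<noteq> - 1" "l \<noteq> 2" "l \<noteq> 1 / 2" by blast
  then show ?thesis
  proof cases
    case 1
    then have ne: "l \<noteq> - 1" "l \<noteq> 2" "l \<noteq> 1 / 2" using W by metis+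
    \<comment> \<open>The maps of order three fix \<open>l\<close>, so the other three cross ratios
      all equal \<open>1 - l\<close>.\<close>
    have "legendre_class l = {l, 1 - l}"
      unfolding cl iffs(3)[THEN iffD2, OF 1] iffs(4)[THEN iffD2, OF 1]
        iffs(6)[THEN iffD2, OF 1] iffs(9)[THEN iffD2, OF 1] by auto
    moreover have "1 - l \<noteq> l" unfolding iffs(1) half by (rule ne(3))
    moreover have "is_sq l" "is_sq (1 - l)"
      using sixth_root_minus_sq[OF 1] is_sq_minus_iff[OF m1, of l] is_sq_minus_iff[OF m1, of "1 - l"] by auto
    ultimately show ?thesis using 1 ne by simp
  next
    case 2
    have l': "1 - l = 2" "1 / (1 - l) = 1 / 2" unfolding 2 by simp_all
    have sqs: "is_sq l = True" "is_sq (1 - l) = is_sq (2 :: 'a)"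
      unfolding l' unfolding 2 using m1 by simp_all
    have ne: "(l = - 1) = True" "(l = 2) = False" "(l = 1 / 2) = False" "(l ^ 2 - l + 1 = 0) = False"
      unfolding 2 using m12 m1h W by blast+
    \<comment> \<open>At -1 the cross ratios are only -1, 2 and 1/2; the value 1/2 comes from the
      pair governed by \<open>1 - l = 2\<close>.\<close>
    have "legendre_class l = {- 1, 2} \<union> (if is_sq (2 :: 'a) then {1 / 2} else {})"
      unfolding cl sqs iffs(2)[THEN iffD2, OF 2] iffs(7)[THEN iffD2, OF 2]
        iffs(15)[THEN iffD2, OF 2, symmetric] l' unfolding 2 by auto
    then show ?thesis unfolding sqs ne
      by (cases "is_sq (2 :: 'a)") (simp_all add: card_special del: insert_iff)
  next
    case 3
    have l': "1 - l = - 1" unfolding 3 by simp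
    have sqs: "is_sq l = is_sq (2 :: 'a)" "is_sq (1 - l) = True"
      unfolding l' unfolding 3 using m1 by simp_all
    have ne: "(l = - 1) = False" "(l = 2) = True" "(l = 1 / 2) = False" "(l ^ 2 - l + 1 = 0) = False"
      unfolding 3 using m12 h2 W by blast+
    have "legendre_class l = {- 1, 2} \<union> (if is_sq (2 :: 'a) then {1 / 2} else {})"
      unfolding cl sqs iffs(5)[THEN iffD2, OF 3] iffs(8)[THEN iffD2, OF 3]
        iffs(10)[THEN iffD2, OF 3, symmetric] l' unfolding 3 by auto
    then show ?thesis unfolding sqs ne
      by (cases "is_sq (2 :: 'a)") (simp_all add: card_special del: insert_iff)
  next
    case 4
    then have h: "2 * l = 1" using half by blast
    have l': "1 - l = l" using h iffs(1) by blast
    have l'': "1 / l = 2" "l - 1 = - l" using h l0(1) l' by (simp_all add: nonzero_divide_eq_eq)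
    have l3: "(l - 1) / l = - 1" unfolding l''(2) using l0(1) by simp
    have sqs: "is_sq l = is_sq (2 :: 'a)" "is_sq (1 - l) = is_sq (2 :: 'a)"
      unfolding l' unfolding 4 by (rule sqhalf)+
    have ne: "(l = - 1) = False" "(l = 2) = False" "(l = 1 / 2) = True" "(l ^ 2 - l + 1 = 0) = False"
      unfolding 4 using m1h h2 W by blast+
    \<comment> \<open>At 1/2 both conditions amount to 2 being a square, so -1 and 2 join the class
      together.\<close>
    have "legendre_class l = {1 / 2} \<union> (if is_sq (2 :: 'a) then {- 1, 2} else {})"
      unfolding cl sqs iffs(14)[THEN iffD2, OF h, symmetric] iffs(11)[THEN iffD2, OF h, symmetric]
        l' l3 l''(1) unfolding 4 by auto
    then show ?thesis unfolding sqs ne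
      by (cases "is_sq (2 :: 'a)") (simp_all add: card_special del: insert_iff)
  next
    case 5
    have "2 * l \<noteq> 1" using 5 half by simp
    then have "distinct [1 / l, (l - 1) / l, 1 / (1 - l), l / (l - 1), 1 - l, l]"
      using 5 by (simp only: distinct.simps list.set insert_iff empty_iff iffs simp_thms)
    then have "card (legendre_class l) = 2 + 2 * of_bool (is_sq l) + 2 * of_bool (is_sq (1 - l))"
      unfolding cl by (rule card_pairs)
    then show ?thesis using 5 by simp
  qed
qed

text \<open>The two roots sum to 1, so a root \<open>w\<close> comes with \<open>1 - w\<close>. They
  are distinct: \<open>2 * w = 1\<close> would turn \<open>4 * (w ^ 2 - w + 1) = 0\<close> into 3 =
  0.\<close>

lemma sixth_roots_card:
  assumes two: "(2 :: 'a::{field, finite}) \<noteq> 0" and three: "(3 :: 'a) \<noteq> 0"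
  shows "(\<Sum>l\<in>(legendre_params :: 'a set). of_bool (l ^ 2 - l + 1 = 0)) \<in> {0, 2 :: real}"
proof -
  let ?W = "{l \<in> legendre_params. l ^ 2 - l + 1 = (0 :: 'a)}"
  have "card ?W = 2" if w: "w \<in> ?W" for w
  proof -
    have w0: "w \<noteq> 0" "w \<noteq> 1" "w ^ 2 - w + 1 = 0" using w by (auto simp: legendre_params_def)
    have "l \<in> ?W \<longleftrightarrow> l = w \<or> l = 1 - w" for l
    proof -
      have "l ^ 2 - l + 1 = (l - w) * (l - (1 - w)) + (w ^ 2 - w + 1)"
        by (simp add: algebra_simps power2_eq_square)
      then have "l ^ 2 - l + 1 = 0 \<longleftrightarrow> l = w \<or> l = 1 - w"
        using w0(3) by simp
      moreover have "l \<in> ?W \<longleftrightarrow> l ^ 2 - l + 1 = 0"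
        by (auto simp: legendre_params_def)
      ultimately show ?thesis by (simp only:)
    qed
    then have "?W = {w, 1 - w}" by blast
    moreover have "w \<noteq> 1 - w"
    proof
      assume "w = 1 - w"
      then have "2 * w = 1" by (simp add: algebra_simps)
      have "4 * (w ^ 2 - w + 1) = (2 * w) ^ 2 - 2 * (2 * w) + 4" by (simp add: algebra_simps power2_eq_square)
      then show False using w0(3) three unfolding \<open>2 * w = 1\<close> by simp
    qed
    ultimately show ?thesis by simp
  qed
  then have "card ?W = 0 \<or> card ?W = 2"
    by (cases "?W = {}") (simp only: card.empty simp_thms, blast)
  moreover have "(\<Sum>l\<in>(legendre_params :: 'a set). of_bool (l ^ 2 - l + 1 = 0)) = real (card ?W)"
    by (simp add: Int_def)
  ultimately show ?thesis by auto
qed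

section \<open>Residues modulo 24\<close>

lemma legendre_count_arith:
  fixes q k N :: nat
  assumes "(4 * k + 5 = q \<and> (24 * N = 7 * q + 1 \<or> 24 * N = 7 * q + 13 \<or> 24 * N = 7 * q + 17 \<or> 24 * N = 7 * q + 29))
     \<or> (4 * k + 3 = q \<and> (3 * N + 2 = q \<or> 3 * N = q + 2))"
  shows "([q = 1] (mod 24) \<longrightarrow> real N = (7 * real q + 17) / 24) \<and>
         ([q = 5] (mod 24) \<longrightarrow> real N = (7 * real q + 13) / 24) \<and>
         ([q = 7] (mod 24) \<or> [q = 19] (mod 24) \<longrightarrow> real N = (real q + 2) / 3) \<and>
         ([q = 11] (mod 24) \<or> [q = 23] (mod 24) \<longrightarrow> real N = (real q - 2) / 3) \<and>
         ([q = 13] (mod 24) \<longrightarrow> real N = (7 * real q + 29) / 24) \<and>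
         ([q = 17] (mod 24) \<longrightarrow> real N = (7 * real q + 1) / 24)"
proof -
  have m4: "q mod 4 = q mod 24 mod 4" and m3: "q mod 3 = q mod 24 mod 3"
    by (simp_all add: mod_mod_cancel)
  have m3': "(q + 2) mod 3 = (q mod 24 + 2) mod 3"
    using m3 mod_add_left_eq[of q 3 2] mod_add_left_eq[of "q mod 24" 3 2] by (simp only:)
  have m24: "(7 * q + c) mod 24 = (7 * (q mod 24) + c) mod 24" for c
    using mod_add_left_eq[of "7 * q" 24 c] mod_add_left_eq[of "7 * (q mod 24)" 24 c]
      mod_mult_right_eq[of 7 q 24] by (simp only:)
  have k1: "q mod 24 mod 4 = 1" if "4 * k + 5 = q"
  proof -
    have "q mod 4 = (5 + 4 * k) mod 4" using that by (simp only: add.commute)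
    then show ?thesis by (simp only: mod_mult_self2 m4[symmetric]) simp
  qed
  have k3: "q mod 24 mod 4 = 3" if "4 * k + 3 = q"
  proof -
    have "q mod 4 = (3 + 4 * k) mod 4" using that by (simp only: add.commute)
    then show ?thesis by (simp only: mod_mult_self2 m4[symmetric]) simp
  qed
  have N24: "(7 * (q mod 24) + c) mod 24 = 0" if "24 * N = 7 * q + c" for c
    unfolding m24[symmetric] that[symmetric] by simp
  have N3: "q mod 24 mod 3 = 2" if "3 * N + 2 = q"
  proof -
    have "q mod 3 = (2 + 3 * N) mod 3" using that by (simp only: add.commute)
    then show ?thesis by (simp only: mod_mult_self2 m3[symmetric]) simp
  qed
  have N3': "(q mod 24 + 2) mod 3 = 0" if "3 * N = q + 2"
    unfolding m3'[symmetric] that[symmetric] by simp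
  have real1: "real N = (7 * real q + 1) / 24" if "24 * N = 7 * q + 1"
    using arg_cong[OF that, of real] by simp
  have real13: "real N = (7 * real q + 13) / 24" if "24 * N = 7 * q + 13"
    using arg_cong[OF that, of real] by simp
  have real17: "real N = (7 * real q + 17) / 24" if "24 * N = 7 * q + 17"
    using arg_cong[OF that, of real] by simp
  have real29: "real N = (7 * real q + 29) / 24" if "24 * N = 7 * q + 29"
    using arg_cong[OF that, of real] by simp
  have real3: "real N = (real q - 2) / 3" if "3 * N + 2 = q"
    using arg_cong[OF that, of real] by simp
  have real3': "real N = (real q + 2) / 3" if "3 * N = q + 2"
    using arg_cong[OF that, of real] by simp
  \<comment> \<open>As 7 is invertible modulo 24, divisibility of \<open>7 * q + c\<close> by 24 for
    c = 1, 13, 17, 29 forces the residues 17, 5, 1, 13. In the other two cases \<open>q\<close> is 3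
    modulo 4, and its residue modulo 3 separates 11, 23 from 7, 19.\<close>
  consider
      "q mod 24 mod 4 = 1" "(7 * (q mod 24) + 1) mod 24 = 0" "real N = (7 * real q + 1) / 24"
    | "q mod 24 mod 4 = 1" "(7 * (q mod 24) + 13) mod 24 = 0" "real N = (7 * real q + 13) / 24"
    | "q mod 24 mod 4 = 1" "(7 * (q mod 24) + 17) mod 24 = 0" "real N = (7 * real q + 17) / 24"
    | "q mod 24 mod 4 = 1" "(7 * (q mod 24) + 29) mod 24 = 0" "real N = (7 * real q + 29) / 24"
    | "q mod 24 mod 4 = 3" "q mod 24 mod 3 = 2" "real N = (real q - 2) / 3"
    | "q mod 24 mod 4 = 3" "(q mod 24 + 2) mod 3 = 0" "real N = (real q + 2) / 3"
    using assms
  proof (elim disjE conjE)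
    assume "4 * k + 5 = q" "24 * N = 7 * q + 1"
    then show thesis by (intro that(1) k1 N24 real1)
  next
    assume "4 * k + 5 = q" "24 * N = 7 * q + 13"
    then show thesis by (intro that(2) k1 N24 real13)
  next
    assume "4 * k + 5 = q" "24 * N = 7 * q + 17"
    then show thesis by (intro that(3) k1 N24 real17)
  next
    assume "4 * k + 5 = q" "24 * N = 7 * q + 29"
    then show thesis by (intro that(4) k1 N24 real29)
  next
    assume "4 * k + 3 = q" "3 * N + 2 = q"
    then show thesis by (intro that(5) k3 N3 real3)
  next
    assume "4 * k + 3 = q" "3 * N = q + 2"
    then show thesis by (intro that(6) k3 N3' real3')
  qed
  moreover define r where "r = q mod 24"
  ultimately show ?thesis
    unfolding cong_def r_def[symmetric] by cases auto
qed

section \<open>Evaluation of the weighted sum\<close>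

theorem theorem3p6:
  fixes q :: nat and N :: nat
  assumes q: "q = CARD('a)"
    and char: "CHAR('a) > 3"
    and N: "N = card (legendre_classes :: 'a::{field, finite} weierstrass set set)"
  shows "([q = 1] (mod 24) \<longrightarrow> real N = (7 * real q + 17) / 24) \<and>
         ([q = 5] (mod 24) \<longrightarrow> real N = (7 * real q + 13) / 24) \<and>
         ([q = 7] (mod 24) \<or> [q = 19] (mod 24) \<longrightarrow> real N = (real q + 2) / 3) \<and>
         ([q = 11] (mod 24) \<or> [q = 23] (mod 24) \<longrightarrow> real N = (real q - 2) / 3) \<and>
         ([q = 13] (mod 24) \<longrightarrow> real N = (7 * real q + 29) / 24) \<and>
         ([q = 17] (mod 24) \<longrightarrow> real N = (7 * real q + 1) / 24)"
proof -
  have two: "(2 :: 'a) \<noteq> 0"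
    using char of_nat_eq_0_iff_char_dvd[of 2, where ?'a = 'a] by (auto dest: dvd_imp_le)
  have three: "(3 :: 'a) \<noteq> 0"
    using char of_nat_eq_0_iff_char_dvd[of 3, where ?'a = 'a] by (auto dest: dvd_imp_le)
  let ?P = "legendre_params :: 'a set"
  define W :: real where "W = (\<Sum>l\<in>?P. of_bool (l ^ 2 - l + 1 = 0))"
  have W: "W = 0 \<or> W = 2"
    using sixth_roots_card[OF two three] by (simp add: W_def)
  note sums = sum_is_sq_params[OF two, folded q]
  have NS: "real N = (\<Sum>l\<in>?P. 1 / real (card (legendre_class l)))"
    unfolding N by (rule card_legendre_classes[OF two])
  \<comment> \<open>Being a cardinality, \<open>k\<close> is an integer; this forces
    \<open>q\<close> to be 1 modulo 4 if -1 is a square and 3 modulo 4 otherwise.\<close>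
  define k where "k = card {l \<in> ?P. is_sq l \<and> is_sq (1 - l)}"
  have k: "real k = (real q - (if is_sq (- 1 :: 'a) then 5 else 3)) / 4"
    unfolding sums(3)[symmetric] by (simp add: k_def Int_def)
  have "(4 * k + 5 = q \<and> (24 * N = 7 * q + 1 \<or> 24 * N = 7 * q + 13 \<or> 24 * N = 7 * q + 17 \<or> 24 * N = 7 * q + 29))
     \<or> (4 * k + 3 = q \<and> (3 * N + 2 = q \<or> 3 * N = q + 2))"
  proof (cases "is_sq (- 1 :: 'a)")
    case True
    have "(2::'a) \<noteq> 1" "(- 1 :: 'a) \<noteq> 1"
      using two by (metis add_cancel_right_left one_add_one one_neq_zero, metis add.right_inverse one_add_one)
    then have mem: "- 1 \<in> ?P" "2 \<in> ?P" "1 / 2 \<in> ?P"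
      using two by (auto simp: legendre_params_def)
    have one: "(\<Sum>l\<in>?P. of_bool (l = c) * d) = d" if "c \<in> ?P" for c and d :: real
    proof -
      have "(\<Sum>l\<in>?P. of_bool (l = c) * d) = (\<Sum>l\<in>?P. if l = c then d else 0)"
        by (rule sum.cong) auto
      then show ?thesis using that by simp
    qed
    have "real N = (\<Sum>l\<in>?P. 1 / 2 - of_bool (is_sq l) / 4 - of_bool (is_sq (1 - l)) / 4
      + of_bool (is_sq l \<and> is_sq (1 - l)) / 6 + of_bool (l ^ 2 - l + 1 = 0) / 3
      + of_bool (l = - 1) * (if is_sq (2 :: 'a) then 1 / 6 else 1 / 4)
      + of_bool (l = 2) * (if is_sq (2 :: 'a) then 1 / 6 else 1 / 4)
      + of_bool (l = 1 / 2) * (if is_sq (2 :: 'a) then 1 / 6 else 1 / 2))"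
      unfolding NS by (rule sum.cong[OF refl card_legendre_class_sq[OF two three True]])
    also have "\<dots> = real (card ?P) / 2 - ((real q - 3) / 2) / 4 - ((real q - 3) / 2) / 4
      + ((real q - 5) / 4) / 6 + W / 3 + (if is_sq (2 :: 'a) then 1 / 6 else 1 / 4)
      + (if is_sq (2 :: 'a) then 1 / 6 else 1 / 4) + (if is_sq (2 :: 'a) then 1 / 6 else 1 / 2)"
      unfolding sum.distrib sum_subtractf one[OF mem(1)] one[OF mem(2)] one[OF mem(3)]
        sum_divide_distrib[symmetric] sums W_def using True by (simp add: sums(4))
    also have "\<dots> = (7 * real q - 11 + 8 * W + (if is_sq (2 :: 'a) then 12 else 24)) / 24"
      unfolding sums(4) by (simp add: field_simps)
    finally have n: "24 * real N = 7 * real q - 11 + 8 * W + (if is_sq (2 :: 'a) then 12 else 24)"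
      by simp
    have "4 * k + 5 = q"
      using k True by simp
    \<comment> \<open>The constants are -11 + 8W + 12 if 2 is a square and -11 + 8W + 24 if not: 1
      and 13 for \<open>W = 0\<close>, 17 and 29 for \<open>W = 2\<close>.\<close>
    moreover have "24 * N = 7 * q + 1 \<or> 24 * N = 7 * q + 13 \<or> 24 * N = 7 * q + 17 \<or> 24 * N = 7 * q + 29"
      using n W by (auto split: if_splits)
    ultimately show ?thesis by blast
  next
    case False
    have "real N = (\<Sum>l\<in>?P. 1 / 3 + 2 / 3 * of_bool (l ^ 2 - l + 1 = 0))"
      unfolding NS by (rule sum.cong[OF refl card_legendre_class_nonsq[OF two False]])
    also have "\<dots> = (real q - 2) / 3 + 2 / 3 * W"
      unfolding sum.distrib W_def sum_distrib_left[symmetric] sums(4)[symmetric] by simp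
    finally have n: "3 * real N = real q - 2 + 2 * W" by simp
    have "4 * k + 3 = q"
      using k False by simp
    \<comment> \<open>The first alternative is \<open>W = 0\<close>, the second
      \<open>W = 2\<close>; writing the first as an addition avoids truncated subtraction.\<close>
    moreover have "3 * N + 2 = q \<or> 3 * N = q + 2"
      using n W by auto
    ultimately show ?thesis by blast
  qed
  then show ?thesis
    by (rule legendre_count_arith)
qed

end
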